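(* Let $T>0$ and let $f:\mathbb{R}\to\mathbb{R}$ be a nonzero $T$-periodic function with $f\in\mathcal{L}^1_{\mathrm{loc}}(\mathbb{R})$. Then $I^{\alpha}f$ cannot be $T$-periodic for any $\alpha\in(0,1)$.
   Context: For $\alpha\in(0,1)$ and $f:\mathbb{R}\to\mathbb{R}$ (not necessarily continuous), the fractional integral (fractional primitive) of $f$ of order $\alpha$ is $$I^{\alpha}f(t)=\frac{1}{\Gamma(\alpha)}\int_0^t (t-s)^{\alpha-1}f(s)\,ds,$$ provided the right-hand side is defined for a.e. $t\in\mathbb{R}$. A function $g$ is $T$-periodic if $g(t+T)=g(t)$ for all $t$. *)

theory Defs
  imports "HOL-Analysis.Analysis"
begin

definition locally_integrable :: "(real \<Rightarrow> real) \<Rightarrow> bool" where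
  "locally_integrable f \<longleftrightarrow> (\<forall>K. compact K \<longrightarrow> f absolutely_integrable_on K)"

text \<open>
  The integral is a Lebesgue integral, equal to 0 where the integrand is not integrable; for
  locally integrable \<open>f\<close> this concerns only a null set of \<open>t\<close>.  For \<open>t < 0\<close> the base
  \<open>t - s\<close> is negative and the real power has no canonical meaning (the library's
  \<open>powr\<close> then uses \<open>\<bar>t - s\<bar>\<close>), so values at negative \<open>t\<close> should not be relied upon.
\<close>

definition frac_integral :: "real \<Rightarrow> (real \<Rightarrow> real) \<Rightarrow> real \<Rightarrow> real" where
  "frac_integral \<alpha> f t = 1 / Gamma \<alpha> * (LINT s=0..t|lebesgue. ((t - s) powr (\<alpha> - 1) * f s))"

end

theory Submission
  imports Defs "HOL-Complex_Analysis.Cauchy_Integral_Formula"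
begin

text \<open>
  Write \<open>F\<close> for the unnormalised fractional integral
  \<open>F t = (\<integral>s\<in>{0<..<t}. (t - s) powr (\<alpha> - 1) * f s)\<close>.  Splitting the integral for
  \<open>F (t + T)\<close> at \<open>s = T\<close> and using the periodicity of \<open>f\<close> on the right part gives
  \<open>F (t + T) = F t + H (t + T)\<close>, where
  \<open>H r = (\<integral>s\<in>{0..T}. (r - s) powr (\<alpha> - 1) * f s)\<close> is the memory that the fractional
  integral keeps of the first period (lemma \<open>frac_integral_periodic_defect\<close>).  So if \<open>F\<close> agrees
  almost everywhere with a \<open>T\<close>-periodic function, then \<open>H\<close> vanishes at almost every \<open>r > T\<close>.

  But \<open>H\<close> determines \<open>f\<close> on \<open>[0, T]\<close>.  For \<open>r > T\<close>, the binomial series gives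
  \<open>r powr (1 - \<alpha>) * H r = (\<Sum>n. ((\<alpha> - 1) gchoose n) * (- 1)^n * m n * (1 / r)^n)\<close>, where
  \<open>m n\<close> is the \<open>n\<close>-th moment of \<open>f\<close> on \<open>[0, T]\<close>.  This power series in \<open>1 / r\<close> has zeros
  accumulating at \<open>0\<close>, so all its coefficients vanish; as \<open>\<alpha> - 1\<close> is not a natural number, no
  binomial coefficient is zero, and therefore all moments vanish
  (\<open>moments_vanish_of_powr_kernel\<close>).  By the Weierstrass approximation theorem an integrable
  function on a compact interval without moments is zero almost everywhere
  (\<open>AE_zero_of_vanishing_moments\<close>), and periodicity carries this from \<open>[0, T]\<close> to the whole line.

  One point needs care.  The Lebesgue integral of a non-integrable function is \<open>0\<close> by convention,
  so the splitting above is only valid at those \<open>t\<close> for which the integrand of \<open>F t\<close> is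
  integrable.  Almost every \<open>t > 0\<close> is of this kind, by Tonelli's theorem
  (\<open>AE_frac_integrand_integrable\<close>).
\<close>

section \<open>Almost everywhere statements on the real line\<close>

lemma AE_lebesgue_translate:
  fixes a :: real
  assumes "AE t in lebesgue. P t"
  shows "AE t in lebesgue. P (t + a)"
proof -
  obtain N where N: "negligible N" "{t. \<not> P t} \<subseteq> N"
    using assms by (auto simp: eventually_ae_filter_negligible)
  have "negligible ((+) (- a) ` N)"
    using N(1) by (rule negligible_translation)
  moreover have "{t. \<not> P (t + a)} \<subseteq> (+) (- a) ` N"
  proof
    fix t assume "t \<in> {t. \<not> P (t + a)}"
    then have "t + a \<in> N" using N(2) by auto
    then show "t \<in> (+) (- a) ` N" by (intro image_eqI[of _ _ "t + a"]) auto
  qed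
  ultimately show ?thesis
    by (auto simp: eventually_ae_filter_negligible)
qed

lemma AE_lebesgue_imp_arbitrarily_large:
  fixes c :: real
  assumes "AE t in lebesgue. t > 0 \<longrightarrow> P t"
  shows "\<exists>t>c. P t"
proof (rule ccontr)
  assume none: "\<not> (\<exists>t>c. P t)"
  obtain N where N: "negligible N" "{t. \<not> (t > 0 \<longrightarrow> P t)} \<subseteq> N"
    using assms by (auto simp: eventually_ae_filter_negligible)
  have "{max c 0 <..< max c 0 + 1} \<subseteq> N"
  proof
    fix t assume "t \<in> {max c 0 <..< max c 0 + 1}"
    then have "t > c" "t > 0" by auto
    then show "t \<in> N" using N(2) none by auto
  qed
  then have "negligible {max c 0 <..< max c 0 + 1}"
    using N(1) negligible_subset by blast
  then show False
    by (simp add: negligible_iff_null_sets null_sets_def)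
qed

section \<open>Power series and binomial coefficients\<close>

text \<open>
  The identity theorem for power series, with zeros approaching the centre from the right.
\<close>
lemma powser_eq_0_of_zeros_accumulating:
  fixes a :: "nat \<Rightarrow> real"
  assumes r: "r > 0"
    and sums: "\<And>x. \<bar>x\<bar> < r \<Longrightarrow> (\<lambda>n. a n * x ^ n) sums \<Phi> x"
    and zeros: "\<And>\<epsilon>. \<epsilon> > 0 \<Longrightarrow> \<exists>x. 0 < x \<and> x < \<epsilon> \<and> \<Phi> x = 0"
  shows "a k = 0"
proof (rule ccontr)
  assume k: "a k \<noteq> 0"
  \<comment> \<open>Isolation of zeros applies to a series that vanishes at its centre; multiplying by \<open>x\<close>
    achieves this and keeps the positive zeros.\<close>
  define b where "b n = (case n of 0 \<Rightarrow> 0 | Suc m \<Rightarrow> a m)" for n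
  have b_sums: "(\<lambda>n. b n * (x - 0) ^ n) sums (x * \<Phi> x)" if "norm (x - 0) < r" for x
  proof -
    have "(\<lambda>n. x * (a n * x ^ n)) sums (x * \<Phi> x)"
      using sums[of x] that by (intro sums_mult) auto
    then have "(\<lambda>n. b (Suc n) * x ^ Suc n) sums (x * \<Phi> x)"
      by (simp add: b_def mult_ac)
    then show ?thesis
      by (subst (asm) sums_Suc_iff) (simp add: b_def)
  qed
  have "b (Suc k) \<noteq> 0" using k by (simp add: b_def)
  then obtain s where s: "s > 0" "\<And>z. z \<in> cball 0 s - {0} \<Longrightarrow> z * \<Phi> z \<noteq> 0"
    using powser_0_nonzero[OF r, of 0 b "\<lambda>x. x * \<Phi> x" "Suc k"] b_sums by auto
  obtain x where "0 < x" "x < s" "\<Phi> x = 0"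
    using zeros[OF s(1)] by blast
  then show False using s(2)[of x] by auto
qed

lemma gbinomial_nonzero:
  fixes \<beta> :: real
  assumes "\<beta> \<notin> \<nat>"
  shows "(\<beta> gchoose n) \<noteq> 0"
proof -
  have "\<beta> - of_nat i \<noteq> 0" for i
    using assms by (metis Nats_cases of_nat_in_Nats eq_iff_diff_eq_0)
  then have "fact n * (\<beta> gchoose n) \<noteq> 0"
    unfolding gbinomial_mult_fact by simp
  then show ?thesis by simp
qed

section \<open>An integrable function on a compact interval is determined by its moments\<close>

lemma integrable_continuous_mult_compact_support:
  fixes h \<phi> :: "real \<Rightarrow> real"
  assumes h: "integrable lebesgue h" and supp: "\<And>x. x \<notin> {a..b} \<Longrightarrow> h x = 0"
    and \<phi>: "continuous_on {a..b} \<phi>"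
  shows "integrable lebesgue (\<lambda>x. \<phi> x * h x)"
proof -
  obtain B where B: "\<And>x. x \<in> {a..b} \<Longrightarrow> \<bar>\<phi> x\<bar> \<le> B"
    using compact_imp_bounded[OF compact_continuous_image[OF \<phi> compact_Icc]]
    unfolding bounded_iff ball_simps real_norm_def by blast
  define \<psi> where "\<psi> x = indicator {a..b} x * \<phi> x" for x
  have "\<psi> \<in> borel_measurable borel"
    using borel_measurable_continuous_on_indicator[OF _ \<phi>] unfolding \<psi>_def by simp
  then have \<psi>: "\<psi> \<in> borel_measurable lebesgue"
    by (simp add: measurable_completion)
  have eq: "\<phi> x * h x = \<psi> x * h x" for x
    using supp[of x] by (cases "x \<in> {a..b}") (auto simp: \<psi>_def)
  have [measurable]: "h \<in> borel_measurable lebesgue" using h by auto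
  note [measurable] = \<psi>
  show ?thesis
  proof (rule Bochner_Integration.integrable_bound)
    show "integrable lebesgue (\<lambda>x. B * h x)" using h by simp
    show "(\<lambda>x. \<phi> x * h x) \<in> borel_measurable lebesgue"
      unfolding eq by measurable
    show "AE x in lebesgue. norm (\<phi> x * h x) \<le> norm (B * h x)"
    proof (intro AE_I2)
      fix x show "norm (\<phi> x * h x) \<le> norm (B * h x)"
      proof (cases "x \<in> {a..b}")
        case True
        then have "\<bar>\<phi> x\<bar> \<le> \<bar>B\<bar>" using B[of x] by linarith
        then show ?thesis by (auto simp: abs_mult intro: mult_right_mono)
      qed (simp add: supp)
    qed
  qed
qed

text \<open>
  Polynomials are uniformly dense in the continuous functions on \<open>[a, b]\<close>, so \<open>h\<close> is orthogonal to
  every continuous function.  The sign of \<open>h\<close> is an almost everywhere limit of continuous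
  functions, which may be taken bounded by \<open>1\<close>; dominated convergence then makes \<open>h\<close> orthogonal
  to its own sign, so that \<open>\<bar>h\<bar>\<close> has integral zero.
\<close>
lemma AE_zero_of_vanishing_moments:
  fixes h :: "real \<Rightarrow> real"
  assumes h: "integrable lebesgue h" and supp: "\<And>x. x \<notin> {a..b} \<Longrightarrow> h x = 0"
    and moments: "\<And>k. (\<integral>x. x ^ k * h x \<partial>lebesgue) = 0"
  shows "AE x in lebesgue. h x = 0"
proof -
  have meas[measurable]: "h \<in> borel_measurable lebesgue" using h by auto
  have int: "integrable lebesgue (\<lambda>x. \<phi> x * h x)" if "continuous_on {a..b} \<phi>" for \<phi>
    using h supp that by (rule integrable_continuous_mult_compact_support)
  have poly: "(\<integral>x. p x * h x \<partial>lebesgue) = 0" if p: "real_polynomial_function p" for p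
  proof -
    obtain c n where p: "p = (\<lambda>x. \<Sum>i\<le>n. c i * x ^ i)"
      using p unfolding real_polynomial_function_iff_sum by blast
    have "(\<integral>x. p x * h x \<partial>lebesgue) = (\<integral>x. (\<Sum>i\<le>n. c i * (x ^ i * h x)) \<partial>lebesgue)"
      by (simp add: p sum_distrib_right mult.assoc)
    also have "\<dots> = (\<Sum>i\<le>n. \<integral>x. c i * (x ^ i * h x) \<partial>lebesgue)"
      by (intro Bochner_Integration.integral_sum integrable_mult_right int)
         (auto intro!: continuous_intros)
    also have "\<dots> = 0" by (simp add: moments)
    finally show ?thesis .
  qed
  have cont: "(\<integral>x. \<phi> x * h x \<partial>lebesgue) = 0" if \<phi>: "continuous_on {a..b} \<phi>" for \<phi>
  proof -
    define I where "I = (\<integral>x. \<bar>h x\<bar> \<partial>lebesgue)"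
    have I: "I \<ge> 0" unfolding I_def by simp
    have "\<bar>\<integral>x. \<phi> x * h x \<partial>lebesgue\<bar> \<le> 0 + e" if e: "e > 0" for e
    proof -
      \<comment> \<open>A uniform error \<open>d\<close> in \<open>\<phi>\<close> changes the integral by at most \<open>d * I\<close>; the \<open>1\<close> covers \<open>I = 0\<close>.\<close>
      define d where "d = e / (I + 1)"
      have "d > 0" using e I by (simp add: d_def)
      then obtain p where p: "real_polynomial_function p"
        "\<And>x. x \<in> {a..b} \<Longrightarrow> \<bar>\<phi> x - p x\<bar> < d"
        using Stone_Weierstrass_real_polynomial_function[OF _ \<phi>] by (metis compact_Icc)
      have p_cont: "continuous_on {a..b} p"
        using p(1) by (simp add: real_polynomial_function_eq continuous_on_polymonial_function)
      have "(\<integral>x. \<phi> x * h x \<partial>lebesgue) = (\<integral>x. \<phi> x * h x \<partial>lebesgue) - (\<integral>x. p x * h x \<partial>lebesgue)"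
        using poly[OF p(1)] by simp
      also have "\<dots> = (\<integral>x. \<phi> x * h x - p x * h x \<partial>lebesgue)"
        by (rule Bochner_Integration.integral_diff[symmetric, OF int[OF \<phi>] int[OF p_cont]])
      also have "\<bar>\<dots>\<bar> \<le> (\<integral>x. d * \<bar>h x\<bar> \<partial>lebesgue)"
      proof (rule order_trans[OF integral_abs_bound], rule integral_mono)
        show "integrable lebesgue (\<lambda>x. \<bar>\<phi> x * h x - p x * h x\<bar>)"
          by (rule integrable_abs[OF Bochner_Integration.integrable_diff[OF int[OF \<phi>] int[OF p_cont]]])
        show "integrable lebesgue (\<lambda>x. d * \<bar>h x\<bar>)" using h by simp
        fix x show "\<bar>\<phi> x * h x - p x * h x\<bar> \<le> d * \<bar>h x\<bar>"
        proof (cases "x \<in> {a..b}")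
          case True
          then show ?thesis using p(2)[of x]
            by (auto simp: left_diff_distrib[symmetric] abs_mult intro!: mult_right_mono)
        qed (simp add: supp)
      qed
      also have "\<dots> = d * I" by (simp add: I_def)
      also have "\<dots> \<le> e" using e I by (simp add: d_def field_simps)
      finally show ?thesis by simp
    qed
    then have "\<bar>\<integral>x. \<phi> x * h x \<partial>lebesgue\<bar> \<le> 0" by (rule field_le_epsilon)
    then show ?thesis by simp
  qed
  have "(\<lambda>x. sgn (h x)) measurable_on UNIV"
    by (rule lebesgue_measurable_imp_measurable_on_real) auto
  then obtain N g where N: "negligible N" and g: "\<And>n. continuous_on UNIV (g n)"
    and lim: "\<And>x. x \<notin> N \<Longrightarrow> (\<lambda>n. g n x) \<longlonglongrightarrow> sgn (h x)"
    unfolding measurable_on_def by auto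
  \<comment> \<open>Truncation to \<open>[- 1, 1]\<close> keeps the limit \<open>sgn (h x)\<close> and provides the dominating function \<open>\<bar>h\<bar>\<close>.\<close>
  define c where "c n x = max (- 1) (min 1 (g n x))" for n x
  have c_cont: "continuous_on S (c n)" for n S
    unfolding c_def
    by (intro continuous_intros continuous_on_subset[OF g]) auto
  have "(\<lambda>n. \<integral>x. c n x * h x \<partial>lebesgue) \<longlonglongrightarrow> (\<integral>x. \<bar>h x\<bar> \<partial>lebesgue)"
  proof (rule integral_dominated_convergence)
    show "integrable lebesgue (\<lambda>x. \<bar>h x\<bar>)" using h by simp
    show "(\<lambda>x. c n x * h x) \<in> borel_measurable lebesgue" for n
      using int[OF c_cont] by auto
    show "AE x in lebesgue. (\<lambda>n. c n x * h x) \<longlonglongrightarrow> \<bar>h x\<bar>"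
    proof (rule AE_mp[OF AE_not_in])
      show "N \<in> null_sets lebesgue" using N by (simp add: negligible_iff_null_sets)
      show "AE x in lebesgue. x \<notin> N \<longrightarrow> (\<lambda>n. c n x * h x) \<longlonglongrightarrow> \<bar>h x\<bar>"
      proof (intro AE_I2 impI)
        fix x assume "x \<notin> N"
        then have "(\<lambda>n. c n x * h x) \<longlonglongrightarrow> max (- 1) (min 1 (sgn (h x))) * h x"
          unfolding c_def by (intro tendsto_intros lim)
        also have "max (- 1) (min 1 (sgn (h x))) * h x = \<bar>h x\<bar>"
          by (auto simp: sgn_if)
        finally show "(\<lambda>n. c n x * h x) \<longlonglongrightarrow> \<bar>h x\<bar>" .
      qed
    qed
    show "AE x in lebesgue. norm (c n x * h x) \<le> \<bar>h x\<bar>" for n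
      by (intro AE_I2) (auto simp: abs_mult c_def intro!: mult_left_le_one_le)
  qed auto
  then have "(\<integral>x. \<bar>h x\<bar> \<partial>lebesgue) = 0"
    using cont[OF c_cont] by (simp add: LIMSEQ_const_iff)
  then show ?thesis
    using h by (subst (asm) integral_nonneg_eq_0_iff_AE) auto
qed

text \<open>
  The integral against \<open>(t - s) powr \<beta>\<close>, divided by \<open>t powr \<beta>\<close>, is a power series in \<open>1 / t\<close> whose
  coefficients are the moments of \<open>h\<close> up to nonzero factors.  Zeros of the integral at arbitrarily
  large \<open>t\<close> are zeros of this series accumulating at \<open>0\<close>.  If \<open>\<beta>\<close> were a natural number, the series
  would be a polynomial and would only see the first \<open>\<beta> + 1\<close> moments.
\<close>
lemma moments_vanish_of_powr_kernel:
  fixes h :: "real \<Rightarrow> real"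
  assumes "\<beta> \<notin> \<nat>" and T: "T > 0"
    and h: "integrable lebesgue h" and supp: "\<And>x. x \<notin> {0..T} \<Longrightarrow> h x = 0"
    and zeros: "\<And>c. \<exists>t>c. (\<integral>s. (t - s) powr \<beta> * h s \<partial>lebesgue) = 0"
  shows "(\<integral>s. s ^ k * h s \<partial>lebesgue) = 0"
proof -
  define m where "m n = (\<integral>s. s ^ n * h s \<partial>lebesgue)" for n
  \<comment> \<open>The normalised integral in the variable \<open>x = 1 / t\<close>, which extends to \<open>\<bar>x\<bar> < 1 / T\<close>.\<close>
  define \<Phi> where "\<Phi> x = (\<integral>s. (1 - x * s) powr \<beta> * h s \<partial>lebesgue)" for x
  have int: "integrable lebesgue (\<lambda>x. \<phi> x * h x)" if "continuous_on {0..T} \<phi>" for \<phi>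
    using h supp that by (rule integrable_continuous_mult_compact_support)
  have int_pow: "integrable lebesgue (\<lambda>s. s ^ n * h s)" for n
    by (intro int continuous_intros)
  have "(\<lambda>n. ((\<beta> gchoose n) * (- 1) ^ n * m n) * x ^ n) sums \<Phi> x" if x: "\<bar>x\<bar> < 1 / T" for x
  proof -
    define u where "u n s = ((\<beta> gchoose n) * (- x) ^ n) * (s ^ n * h s)" for n s
    have xT: "\<bar>x * T\<bar> < 1" using x T by (simp add: abs_mult field_simps)
    have summ: "summable (\<lambda>n. norm ((\<beta> gchoose n) * (x * T) ^ n))"
      by (rule abs_summable_in_conv_radius) (use xT in \<open>auto simp: conv_radius_gchoose\<close>)
    \<comment> \<open>This majorant is summable in \<open>n\<close> and integrable in \<open>s\<close>, which allows sum and integral to be exchanged.\<close>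
    have bound: "norm (u n s) \<le> norm ((\<beta> gchoose n) * (x * T) ^ n) * \<bar>h s\<bar>" for n s
    proof (cases "s \<in> {0..T}")
      case True
      have "\<bar>x\<bar> ^ n * s ^ n \<le> \<bar>x\<bar> ^ n * T ^ n"
        using True by (intro mult_left_mono power_mono) auto
      then have "\<bar>\<beta> gchoose n\<bar> * (\<bar>x\<bar> ^ n * s ^ n) * \<bar>h s\<bar> \<le> \<bar>\<beta> gchoose n\<bar> * (\<bar>x\<bar> ^ n * T ^ n) * \<bar>h s\<bar>"
        by (rule mult_right_mono[OF mult_left_mono]) auto
      then show ?thesis using True T
        by (simp add: u_def abs_mult power_abs power_mult_distrib mult_ac)
    qed (simp add: u_def supp)
    have int_u: "integrable lebesgue (u n)" for n
      unfolding u_def by (intro integrable_mult_right int_pow)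
    have "(\<lambda>n. integral\<^sup>L lebesgue (u n)) sums (\<integral>s. (\<Sum>n. u n s) \<partial>lebesgue)"
    proof (rule sums_integral[OF int_u])
      show "AE s in lebesgue. summable (\<lambda>n. norm (u n s))"
        using bound
        by (intro AE_I2 summable_comparison_test'[OF summable_mult2[OF summ]]) auto
      show "summable (\<lambda>n. \<integral>s. norm (u n s) \<partial>lebesgue)"
      proof (rule summable_comparison_test'[OF summable_mult2[OF summ, of "\<integral>s. \<bar>h s\<bar> \<partial>lebesgue"]])
        fix n
        have "(\<integral>s. norm (u n s) \<partial>lebesgue)
            \<le> (\<integral>s. norm ((\<beta> gchoose n) * (x * T) ^ n) * \<bar>h s\<bar> \<partial>lebesgue)"
          using bound h by (intro integral_mono integrable_norm int_u) auto
        then show "norm (\<integral>s. norm (u n s) \<partial>lebesgue)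
            \<le> norm ((\<beta> gchoose n) * (x * T) ^ n) * (\<integral>s. \<bar>h s\<bar> \<partial>lebesgue)"
          by simp
      qed
    qed
    also have "(\<integral>s. (\<Sum>n. u n s) \<partial>lebesgue) = \<Phi> x"
      unfolding \<Phi>_def
    proof (intro Bochner_Integration.integral_cong refl)
      fix s
      show "(\<Sum>n. u n s) = (1 - x * s) powr \<beta> * h s"
      proof (cases "s \<in> {0..T}")
        case True
        have "\<bar>x\<bar> * s \<le> \<bar>x\<bar> * T" using True by (intro mult_left_mono) auto
        then have "\<bar>- (x * s)\<bar> < 1" using xT True T by (simp add: abs_mult)
        from sums_mult2[OF gen_binomial_real[OF this, of \<beta>], of "h s"]
        have "(\<lambda>n. u n s) sums ((1 - x * s) powr \<beta> * h s)"
          by (simp only: u_def power_mult_distrib mult.assoc diff_conv_add_uminus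
              minus_mult_left)
        then show ?thesis by (rule sums_unique[symmetric])
      qed (simp add: u_def supp)
    qed
    finally show ?thesis
      unfolding u_def[abs_def] integral_mult_right_zero m_def[symmetric]
      by (simp add: power_minus[of x] mult_ac)
  qed
  moreover have "\<exists>x. 0 < x \<and> x < \<epsilon> \<and> \<Phi> x = 0" if \<epsilon>: "\<epsilon> > 0" for \<epsilon>
  proof -
    obtain t where t: "t > max T (1 / \<epsilon>)" and zero: "(\<integral>s. (t - s) powr \<beta> * h s \<partial>lebesgue) = 0"
      using zeros by blast
    have "t > 0" using t T by auto
    have "\<Phi> (1 / t) = (\<integral>s. t powr (- \<beta>) * ((t - s) powr \<beta> * h s) \<partial>lebesgue)"
      unfolding \<Phi>_def
    proof (intro Bochner_Integration.integral_cong refl)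
      fix s
      show "(1 - 1 / t * s) powr \<beta> * h s = t powr (- \<beta>) * ((t - s) powr \<beta> * h s)"
      proof (cases "s \<in> {0..T}")
        case True
        have "1 - 1 / t * s = (t - s) / t" using \<open>t > 0\<close> by (simp add: field_simps)
        then show ?thesis using True t \<open>t > 0\<close>
          by (simp add: powr_divide powr_minus_divide)
      qed (simp add: supp)
    qed
    also have "\<dots> = 0" by (simp add: zero)
    finally show ?thesis
      using t \<open>t > 0\<close> \<epsilon> by (intro exI[of _ "1 / t"]) (auto simp: field_simps)
  qed
  ultimately have "(\<beta> gchoose k) * (- 1) ^ k * m k = 0"
    using powser_eq_0_of_zeros_accumulating[of "1 / T"
        "\<lambda>n. (\<beta> gchoose n) * (- 1) ^ n * m n" \<Phi> k] T by auto
  then show ?thesis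
    using gbinomial_nonzero[OF \<open>\<beta> \<notin> \<nat>\<close>, of k] by (simp add: m_def)
qed

section \<open>The memory of the first period\<close>

text \<open>
  By Tonelli's theorem and translation invariance, the double integral of \<open>\<bar>k (t - s) * h s\<bar>\<close> is
  the product of the \<open>L\<^sup>1\<close> norms of \<open>k\<close> and \<open>h\<close>, so the inner integral is finite for almost
  every \<open>t\<close>.
\<close>
lemma AE_convolution_integrable:
  fixes k h :: "real \<Rightarrow> real"
  assumes k: "integrable lborel k" and h: "integrable lborel h"
  shows "AE t in lborel. integrable lborel (\<lambda>s. k (t - s) * h s)"
proof -
  have [measurable]: "k \<in> borel_measurable borel" "h \<in> borel_measurable borel"
    using k h by auto
  have "(\<integral>\<^sup>+t. (\<integral>\<^sup>+s. ennreal \<bar>k (t - s) * h s\<bar> \<partial>lborel) \<partial>lborel)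
      = (\<integral>\<^sup>+s. (\<integral>\<^sup>+t. ennreal \<bar>k (t - s) * h s\<bar> \<partial>lborel) \<partial>lborel)"
    by (rule lborel_pair.Fubini') measurable
  also have "\<dots> = (\<integral>\<^sup>+s. (\<integral>\<^sup>+t. ennreal \<bar>k t\<bar> \<partial>lborel) * ennreal \<bar>h s\<bar> \<partial>lborel)"
  proof (rule nn_integral_cong)
    fix s :: real
    have "(\<integral>\<^sup>+t. ennreal \<bar>k (t - s) * h s\<bar> \<partial>lborel)
        = (\<integral>\<^sup>+t. ennreal \<bar>k (- s + 1 * t)\<bar> \<partial>lborel) * ennreal \<bar>h s\<bar>"
      by (simp add: abs_mult ennreal_mult nn_integral_multc)
    also have "(\<integral>\<^sup>+t. ennreal \<bar>k (- s + 1 * t)\<bar> \<partial>lborel) = (\<integral>\<^sup>+t. ennreal \<bar>k t\<bar> \<partial>lborel)"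
      using nn_integral_real_affine[of "\<lambda>t. ennreal \<bar>k t\<bar>" 1 "- s"] by simp
    finally show "(\<integral>\<^sup>+t. ennreal \<bar>k (t - s) * h s\<bar> \<partial>lborel)
        = (\<integral>\<^sup>+t. ennreal \<bar>k t\<bar> \<partial>lborel) * ennreal \<bar>h s\<bar>" .
  qed
  also have "\<dots> = (\<integral>\<^sup>+t. ennreal \<bar>k t\<bar> \<partial>lborel) * (\<integral>\<^sup>+s. ennreal \<bar>h s\<bar> \<partial>lborel)"
    by (rule nn_integral_cmult) measurable
  also have "\<dots> < \<infinity>"
    using k h by (simp add: integrable_iff_bounded ennreal_mult_less_top)
  finally have "AE t in lborel. (\<integral>\<^sup>+s. ennreal \<bar>k (t - s) * h s\<bar> \<partial>lborel) \<noteq> \<infinity>"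
    by (intro nn_integral_PInf_AE) auto
  then show ?thesis
    by eventually_elim (simp add: integrable_iff_bounded less_top)
qed

text \<open>
  For \<open>t \<le> N\<close> the integrand is that of the convolution of \<open>f\<close>, cut off to \<open>[0, N]\<close>, with the
  kernel \<open>x powr (\<alpha> - 1)\<close>, also cut off to \<open>[0, N]\<close>; the kernel is integrable at \<open>0\<close> because
  \<open>\<alpha> > 0\<close>.
\<close>
lemma AE_frac_integrand_integrable:
  fixes f :: "real \<Rightarrow> real"
  assumes f: "set_integrable lebesgue {0..N} f" and \<alpha>: "0 < \<alpha>"
  shows "AE t in lebesgue. 0 < t \<and> t \<le> N \<longrightarrow>
           set_integrable lebesgue {0<..<t} (\<lambda>s. (t - s) powr (\<alpha> - 1) * f s)"
proof (cases "N \<ge> 0")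
  case True
  define k :: "real \<Rightarrow> real" where "k x = indicator {0..N} x * x powr (\<alpha> - 1)" for x
  have "(\<lambda>x. x powr (\<alpha> - 1)) absolutely_integrable_on {0..N}"
    using integrable_on_powr_from_0[of "\<alpha> - 1" N] \<alpha> True
    by (intro nonnegative_absolutely_integrable_1) auto
  then have "integrable lebesgue k"
    by (simp add: set_integrable_def k_def[abs_def])
  then have k: "integrable lborel k"
    by (subst (asm) integrable_completion) (simp_all add: k_def[abs_def])
  define f0 where "f0 s = indicator {0..N} s * f s" for s
  have f0: "integrable lebesgue f0"
    using f by (simp add: set_integrable_def f0_def[abs_def])
  \<comment> \<open>Fubini's theorem needs joint Borel measurability of \<open>k (t - s) * h s\<close>, hence the passage to a
    Borel version \<open>h\<close> of \<open>f0\<close>.\<close>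
  then obtain h where h[measurable]: "h \<in> borel_measurable lborel"
    and fh: "AE s in lborel. f0 s = h s"
    using completion_ex_borel_measurable_real[of f0 lborel] by auto
  have fh': "AE s in lebesgue. f0 s = h s" using fh by (rule AE_completion)
  have "integrable lebesgue h"
    using integrable_cong_AE_imp[OF f0 _ fh'] h by (auto simp: measurable_completion)
  then have "integrable lborel h"
    using h by (simp add: integrable_completion)
  from AE_completion[OF AE_convolution_integrable[OF k this]]
  show ?thesis
  proof eventually_elim
    case (elim t)
    show ?case
    proof
      assume t: "0 < t \<and> t \<le> N"
      have "integrable lebesgue (\<lambda>s. k (t - s) * h s)"
        using elim by (subst integrable_completion) auto
      then have "integrable lebesgue (\<lambda>s. k (t - s) * f0 s)"
      proof (rule integrable_cong_AE_imp)
        have "(\<lambda>s. k (t - s)) \<in> borel_measurable borel" unfolding k_def by measurable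
        then show "(\<lambda>s. k (t - s) * f0 s) \<in> borel_measurable lebesgue"
          using f0 by (intro borel_measurable_times) (auto simp: measurable_completion)
        show "AE s in lebesgue. k (t - s) * h s = k (t - s) * f0 s"
          using fh' by eventually_elim simp
      qed
      then have "integrable lebesgue (\<lambda>s. indicator {0<..<t} s *\<^sub>R (k (t - s) * f0 s))"
        by (rule integrable_mult_indicator[rotated]) auto
      also have "(\<lambda>s. indicator {0<..<t} s *\<^sub>R (k (t - s) * f0 s))
          = (\<lambda>s. indicator {0<..<t} s *\<^sub>R ((t - s) powr (\<alpha> - 1) * f s))"
        using t by (auto simp: fun_eq_iff k_def f0_def split: split_indicator)
      finally show "set_integrable lebesgue {0<..<t} (\<lambda>s. (t - s) powr (\<alpha> - 1) * f s)"
        by (simp add: set_integrable_def)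
    qed
  qed
qed auto

text \<open>
  The interval \<open>(0, t + T)\<close> is cut at \<open>T\<close>: on the right part the substitution \<open>s \<mapsto> s - T\<close> and the
  periodicity of \<open>f\<close> reproduce the integral for \<open>t\<close>, integrable by assumption; on the left part
  the integrand is integrable because \<open>t + T - s \<ge> t > 0\<close> makes the kernel continuous.  Without
  integrability of both parts the integrals could not be added.
\<close>
lemma frac_integral_periodic_defect:
  fixes f :: "real \<Rightarrow> real"
  assumes per: "\<And>x. f (x + T) = f x" and T: "T > 0" and t: "t > 0"
    and f: "set_integrable lebesgue {0..T} f"
    and int: "set_integrable lebesgue {0<..<t} (\<lambda>s. (t - s) powr (\<alpha> - 1) * f s)"
  shows "frac_integral \<alpha> f (t + T) = frac_integral \<alpha> f t +
     1 / Gamma \<alpha> * (\<integral>s. (t + T - s) powr (\<alpha> - 1) * (indicator {0..T} s * f s) \<partial>lebesgue)"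
proof -
  define w where "w s = (t + T - s) powr (\<alpha> - 1)" for s
  define u where "u s = indicator {0<..<t} s * ((t - s) powr (\<alpha> - 1) * f s)" for s
  define v where "v s = w s * (indicator {0..T} s * f s)" for s
  have u: "integrable lebesgue u"
    using int by (simp add: set_integrable_def u_def[abs_def])
  have v: "integrable lebesgue v"
    unfolding v_def
  proof (rule integrable_continuous_mult_compact_support)
    show "integrable lebesgue (\<lambda>s. indicator {0..T} s * f s)"
      using f by (simp add: set_integrable_def)
    show "continuous_on {0..T} w"
      unfolding w_def using t by (intro continuous_intros) auto
  qed auto
  have shift: "integrable lebesgue (\<lambda>s. u (- T + 1 * s))"
    using lebesgue_integrable_real_affine_iff[of 1 u "- T"] u by simp
  have F: "frac_integral \<alpha> f r = 1 / Gamma \<alpha> *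
      (\<integral>s. indicator {0<..<r} s * ((r - s) powr (\<alpha> - 1) * f s) \<partial>lebesgue)" if "r > 0" for r
    using that by (simp add: frac_integral_def zero_ereal_def interval_lebesgue_integral_le_eq set_lebesgue_integral_def)
  have "frac_integral \<alpha> f (t + T) = 1 / Gamma \<alpha> * (\<integral>s. u (- T + 1 * s) + v s \<partial>lebesgue)"
    unfolding F[OF add_pos_pos[OF t T]]
  \<comment> \<open>The two integrands differ at most at the cut points \<open>0\<close> and \<open>T\<close>.\<close>
  proof (rule arg_cong[of _ _ "(*) _"], rule integral_discrete_difference[where X = "{0, T}"])
    fix s assume "s \<notin> {0, T}"
    moreover have "f (s - T) = f s" using per[of "s - T"] by simp
    ultimately show "indicator {0<..<t + T} s * ((t + T - s) powr (\<alpha> - 1) * f s)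
        = u (- T + 1 * s) + v s"
      using T t by (auto simp: u_def v_def w_def algebra_simps split: split_indicator)
  qed auto
  also have "\<dots> = 1 / Gamma \<alpha> * (\<integral>s. u (- T + 1 * s) \<partial>lebesgue) + 1 / Gamma \<alpha> * integral\<^sup>L lebesgue v"
    using shift v by (simp add: distrib_left)
  also have "(\<integral>s. u (- T + 1 * s) \<partial>lebesgue) = integral\<^sup>L lebesgue u"
    using lebesgue_integral_real_affine[of 1 u "- T"] by simp
  finally show ?thesis
    using F[OF t] by (simp add: u_def[abs_def] v_def[abs_def] w_def)
qed

section \<open>Fractional integrals of periodic functions are not periodic\<close>

theorem theorem3p1:
  fixes T \<alpha> :: real and f :: "real \<Rightarrow> real"
  assumes "T > 0"
    and "periodic_fun_simple f T"
    and "locally_integrable f"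
    and "\<not> (AE t in lebesgue. f t = 0)"
    and "0 < \<alpha>" and "\<alpha> < 1"
  shows "\<not> (\<exists>g. periodic_fun_simple g T \<and>
             (AE t in lebesgue. t > 0 \<longrightarrow> g t = frac_integral \<alpha> f t))"
proof
  assume "\<exists>g. periodic_fun_simple g T \<and>
             (AE t in lebesgue. t > 0 \<longrightarrow> g t = frac_integral \<alpha> f t)"
  then obtain g where g: "periodic_fun_simple g T"
    and gF: "AE t in lebesgue. t > 0 \<longrightarrow> g t = frac_integral \<alpha> f t" by blast
  interpret f: periodic_fun_simple f T by fact
  interpret g: periodic_fun_simple g T by fact
  have loc: "set_integrable lebesgue {a..b} f" for a b
    using \<open>locally_integrable f\<close> unfolding locally_integrable_def by blast
  define h where "h s = indicator {0..T} s * f s" for s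
  \<comment> \<open>For \<open>t > T\<close>, up to the factor \<open>1 / Gamma \<alpha>\<close>, this is the contribution of the first period to the fractional integral at \<open>t\<close>.\<close>
  define H where "H t = (\<integral>s. (t - s) powr (\<alpha> - 1) * h s \<partial>lebesgue)" for t
  have "AE t in lebesgue. \<forall>n::nat. 0 < t \<and> t \<le> real n \<longrightarrow>
      set_integrable lebesgue {0<..<t} (\<lambda>s. (t - s) powr (\<alpha> - 1) * f s)"
    unfolding AE_all_countable
    by (intro allI AE_frac_integrand_integrable loc \<open>0 < \<alpha>\<close>)
  with gF AE_lebesgue_translate[OF gF, of T]
  have "AE t in lebesgue. t > 0 \<longrightarrow> H (t + T) = 0"
  proof eventually_elim
    case (elim t)
    show ?case
    proof
      assume t: "t > 0"
      obtain n :: nat where "t \<le> real n" using real_arch_simple by blast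
      then have "frac_integral \<alpha> f (t + T) = frac_integral \<alpha> f t + 1 / Gamma \<alpha> * H (t + T)"
        using frac_integral_periodic_defect[OF f.plus_period \<open>T > 0\<close> t loc, of \<alpha>] elim(3) t
        by (simp add: H_def h_def)
      moreover have "frac_integral \<alpha> f (t + T) = frac_integral \<alpha> f t"
        using elim(1,2) t \<open>T > 0\<close> g.plus_period[of t] by simp
      moreover have "Gamma \<alpha> > 0" using \<open>0 < \<alpha>\<close> by (rule Gamma_real_pos)
      ultimately show "H (t + T) = 0" by simp
    qed
  qed
  then have zeros: "\<exists>t>c. H t = 0" for c
    using AE_lebesgue_imp_arbitrarily_large[of "\<lambda>t. H (t + T) = 0" "c - T"]
    by (metis diff_less_eq)
  have h: "integrable lebesgue h"
    using loc[of 0 T] by (simp add: set_integrable_def h_def[abs_def])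
  have supp: "h x = 0" if "x \<notin> {0..T}" for x using that by (simp add: h_def)
  have "\<alpha> - 1 \<notin> \<nat>"
    using \<open>\<alpha> < 1\<close> by (auto elim!: Nats_cases)
  from moments_vanish_of_powr_kernel[OF this \<open>T > 0\<close> h supp zeros[unfolded H_def]]
  have "AE x in lebesgue. h x = 0"
    by (intro AE_zero_of_vanishing_moments[OF h supp])
  then have "AE x in lebesgue. \<forall>n::int. h (x + of_int n * T) = 0"
    unfolding AE_all_countable by (intro allI AE_lebesgue_translate)
  then have "AE x in lebesgue. f x = 0"
  proof eventually_elim
    case (elim x)
    \<comment> \<open>The translation by \<open>n\<close> periods that moves \<open>x\<close> into \<open>[0, T]\<close>.\<close>
    define n where "n = - \<lfloor>x / T\<rfloor>"
    have "x + of_int n * T \<in> {0..T}"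
      using \<open>T > 0\<close> floor_divide_lower[of T x] floor_divide_upper[of T x]
      by (auto simp: n_def algebra_simps)
    then have "f (x + of_int n * T) = 0"
      using elim[rule_format, of n] by (simp add: h_def)
    then show "f x = 0" by (simp add: f.plus_of_int)
  qed
  with \<open>\<not> (AE t in lebesgue. f t = 0)\<close> show False by simp
qed

end
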